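(* For every constant $\epsilon>0$, there is no deterministic $o(n^2)$-query $(4-\epsilon)$-approximation algorithm for the metric $1$-median problem. That is, there is no deterministic algorithm $A$ such that (i) for every $n$ and every metric space $([n],d)$, $A$ with oracle access to $([n],d)$ makes at most $q(n)$ distance queries, where $q(n)=o(n^2)$, and (ii) for every $n$ and every metric space $([n],d)$, the output $p\in[n]$ of $A$ satisfies $\sum_{y\in[n]} d(p,y)\le (4-\epsilon)\min_{x'\in[n]}\sum_{y\in[n]} d(x',y)$.
   Context: For $n\in\mathbb{N}$, $[n]=\{1,2,\ldots,n\}$. An $n$-point metric space $([n],d)$ is the set $[n]$ with a function $d\colon[n]\times[n]\to\mathbb{R}$ that is nonnegative, satisfies $d(x,y)=0$ iff $x=y$, is symmetric, and satisfies the triangle inequality. An algorithm with oracle access to $([n],d)$ is given $n$ and may query $d$ on any pair $(x,y)\in[n]\times[n]$ to obtain $d(x,y)$; its query complexity is the number of such queries. The metric $1$-median problem asks, given oracle access to a finite metric space $([n],d)$, for a point of $[n]$ with minimum average (equivalently, total) distance to all points of $[n]$. An algorithm for this problem is $\alpha$-approximate ($\alpha\ge1$) if on every input it outputs $x\in[n]$ with $\sum_{y\in[n]} d(x,y)\le\alpha\min_{x'\in[n]}\sum_{y\in[n]}d(x',y)$. *)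

theory Defs
  imports "HOL-Analysis.Analysis" "HOL-Library.Landau_Symbols"
begin

datatype action = Query nat nat | Output nat

text \<open>
  A deterministic oracle algorithm chooses its next action from the input size \<open>n\<close> and the
  list of oracle answers received so far. The earlier queries need not be recorded, since they
  are determined by \<open>n\<close> and the answers. No uniformity or computability in \<open>n\<close> is imposed: only
  queries are counted.
\<close>

type_synonym algorithm = "nat \<Rightarrow> real list \<Rightarrow> action"

text \<open>
  \<open>runs A n d h k p\<close>: continuing from the answers \<open>h\<close>, the algorithm makes exactly \<open>k\<close> further
  queries (repetitions counted), all inside \<open>{1..n} \<times> {1..n}\<close>, and then outputs \<open>p\<close>.
  A computation that queries forever, or queries a pair outside \<open>{1..n} \<times> {1..n}\<close>, has no run;
  hence values of \<open>d\<close> outside \<open>{1..n} \<times> {1..n}\<close> are irrelevant.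
\<close>

inductive runs :: "algorithm \<Rightarrow> nat \<Rightarrow> (nat \<Rightarrow> nat \<Rightarrow> real) \<Rightarrow> real list \<Rightarrow> nat \<Rightarrow> nat \<Rightarrow> bool"
  for A :: algorithm and n :: nat and d :: "nat \<Rightarrow> nat \<Rightarrow> real"
where
  finish: "A n h = Output p \<Longrightarrow> runs A n d h 0 p"
| ask: "A n h = Query x y \<Longrightarrow> x \<in> {1..n} \<Longrightarrow> y \<in> {1..n} \<Longrightarrow>
    runs A n d (h @ [d x y]) k p \<Longrightarrow> runs A n d h (Suc k) p"

lemma runs_deterministic:
  assumes "runs A n d h k p" and "runs A n d h k' p'"
  shows "k = k' \<and> p = p'"
  using assms
proof (induction arbitrary: k' p' rule: runs.induct)
  case (finish h p)
  from finish(2) show ?case by cases (use finish(1) in auto)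
next
  case (ask h x y k p)
  note step = ask.hyps(1) and IH = ask.IH
  from ask.prems show ?case
  proof cases
    case finish
    with step show ?thesis by simp
  next
    case (ask x' y' k'')
    with step have "runs A n d (h @ [d x y]) k'' p'" by simp
    from IH[OF this] ask show ?thesis by simp
  qed
qed

text \<open>
  Inputs are the metrics on \<open>{1..n}\<close> with \<open>n \<ge> 1\<close>; for \<open>n = 0\<close> there is no point to output.
  The locale \<open>Metric_space\<close> demands nonnegativity and symmetry of \<open>d\<close> off the carrier as well; every
  metric on \<open>{1..n}\<close> has such an extension and no run can see it.
\<close>

definition query_complexity_le :: "algorithm \<Rightarrow> (nat \<Rightarrow> nat) \<Rightarrow> bool" where
  "query_complexity_le A q \<longleftrightarrow>
     (\<forall>n\<ge>1. \<forall>d. Metric_space {1..n} d \<longrightarrow> (\<exists>k p. runs A n d [] k p \<and> k \<le> q n))"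

definition total_dist :: "nat \<Rightarrow> (nat \<Rightarrow> nat \<Rightarrow> real) \<Rightarrow> nat \<Rightarrow> real" where
  "total_dist n d x = (\<Sum>y\<in>{1..n}. d x y)"

definition approximates_median :: "algorithm \<Rightarrow> real \<Rightarrow> bool" where
  "approximates_median A \<alpha> \<longleftrightarrow>
     (\<forall>n\<ge>1. \<forall>d. Metric_space {1..n} d \<longrightarrow>
        (\<exists>k p. runs A n d [] k p \<and> p \<in> {1..n} \<and>
           total_dist n d p \<le> \<alpha> * (MIN x'\<in>{1..n}. total_dist n d x')))"

end

(* An adversary fixes a small set S of candidate medians, of size m = delta n, and calls a point high
   once it occurs in more than m queries. Two points of S are at distance 3; a pair with one point in S
   is at distance 3, or 4 if the point in S is high; a pair outside S is at distance 2, or 4 if one of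
   its points is high. With o(n^2) queries only few points are high, so some z in S stays low, and every
   answer involving z is 3. Hence z can afterwards be planted at distance 1 from all low points
   outside S to which its distance is unknown: any two of these are at distance 2, and the distances
   from a third point to z and to such a point differ by at most 1, since they are 3 and one of
   2, 3, 4. The average distance from z is then about 1, but from the output, which may be
   declared high, it is about 4. *)

theory Submission
  imports Defs
begin

section \<open>Degrees and first queries in a list of pairs\<close>

text \<open>Repetitions count, so dummy queries can raise a degree at will.\<close>

definition deg :: "(nat \<times> nat) list \<Rightarrow> nat \<Rightarrow> nat" where
  "deg qs x = length (filter (\<lambda>e. fst e = x \<or> snd e = x) qs)"

definition queried :: "(nat \<times> nat) list \<Rightarrow> nat \<Rightarrow> nat \<Rightarrow> bool" where
  "queried qs x y \<longleftrightarrow> (x, y) \<in> set qs \<or> (y, x) \<in> set qs"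

text \<open>For a pair never queried this is the whole list, so distances not yet revealed follow
  the final degrees.\<close>

definition before :: "(nat \<times> nat) list \<Rightarrow> nat \<Rightarrow> nat \<Rightarrow> (nat \<times> nat) list" where
  "before qs x y = takeWhile (\<lambda>e. e \<noteq> (x, y) \<and> e \<noteq> (y, x)) qs"

lemma deg_simps [simp]:
  "deg [] x = 0"
  "deg (qs @ rs) x = deg qs x + deg rs x"
  "deg [e] x = (if fst e = x \<or> snd e = x then 1 else 0)"
  by (auto simp: deg_def)

lemma deg_replicate_self: "deg (replicate k (p, p)) p = k"
  by (simp add: deg_def)

lemma deg_before_le: "deg (before qs x y) v \<le> deg qs v"
proof -
  have "qs = before qs x y @ dropWhile (\<lambda>e. e \<noteq> (x, y) \<and> e \<noteq> (y, x)) qs"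
    by (simp add: before_def)
  then show ?thesis
    by (metis deg_simps(2) le_add1)
qed

lemma before_commute: "before qs x y = before qs y x"
  unfolding before_def by (rule arg_cong[where f = "\<lambda>P. takeWhile P qs"]) auto

lemma before_unqueried: "\<not> queried qs x y \<Longrightarrow> before qs x y = qs"
  unfolding before_def queried_def by (subst takeWhile_eq_all_conv) auto

lemma before_append: "queried qs x y \<Longrightarrow> before (qs @ rs) x y = before qs x y"
  unfolding before_def queried_def by (auto intro: takeWhile_append1)

lemma before_snoc: "before (qs @ [(x, y)]) x y = before qs x y"
proof (cases "queried qs x y")
  case True
  then show ?thesis by (rule before_append)
next
  case False
  then have "takeWhile (\<lambda>e. e \<noteq> (x, y) \<and> e \<noteq> (y, x)) (qs @ [(x, y)]) = qs"
    by (subst takeWhile_append2) (auto simp: queried_def)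
  with False show ?thesis by (simp add: before_unqueried) (simp add: before_def)
qed

lemma queried_snoc:
  "queried (qs @ [e]) x y \<longleftrightarrow> queried qs x y \<or> e = (x, y) \<or> e = (y, x)"
  by (auto simp: queried_def)

text \<open>Each new partner costs a query at \<open>x\<close> and is counted only if the degree of
  \<open>x\<close> was at most \<open>T\<close> before it. The bound by \<open>deg qs x\<close> is
  what yields \<open>Suc T\<close> in the induction step. For a high \<open>x\<close> these partners
  are the ones whose distance was frozen too early.\<close>

lemma card_queried_early_le:
  "finite {y. queried qs x y \<and> deg (before qs x y) x \<le> T} \<and>
   card {y. queried qs x y \<and> deg (before qs x y) x \<le> T} \<le> min (deg qs x) (Suc T)"
proof (induction qs rule: rev_induct)
  case Nil
  then show ?case by (simp add: queried_def)
next
  case (snoc e qs)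
  let ?E = "\<lambda>qs. {y. queried qs x y \<and> deg (before qs x y) x \<le> T}"
  define y where "y = (if fst e = x then snd e else fst e)"
  have new: "e = (x, w) \<or> e = (w, x) \<longleftrightarrow> (fst e = x \<or> snd e = x) \<and> w = y" for w
    by (cases e) (auto simp: y_def)
  have *: "w \<in> ?E (qs @ [e]) \<longleftrightarrow>
      w \<in> ?E qs \<or> w = y \<and> \<not> queried qs x y \<and> (fst e = x \<or> snd e = x) \<and> deg qs x \<le> T" for w
  proof (cases "queried qs x w")
    case True
    then show ?thesis by (auto simp: before_append queried_snoc)
  next
    case False
    have "before (qs @ [e]) x w = qs" if "e = (x, w) \<or> e = (w, x)"
      using that before_snoc[of qs x w] before_snoc[of qs w x] before_unqueried[OF False]
        before_commute by metis
    then show ?thesis using False new by (auto simp: queried_snoc)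
  qed
  show ?case
  proof (cases "\<not> queried qs x y \<and> (fst e = x \<or> snd e = x) \<and> deg qs x \<le> T")
    case True
    then have "?E (qs @ [e]) = insert y (?E qs)" using * by blast
    with snoc True show ?thesis by (auto simp: card_insert_if)
  next
    case False
    then have "?E (qs @ [e]) = ?E qs" using * by blast
    with snoc show ?thesis by auto
  qed
qed

lemma card_queried_le:
  "finite {y. queried qs x y}" "card {y. queried qs x y} \<le> deg qs x"
proof -
  have "deg (before qs x y) x \<le> deg qs x" for y
    by (rule deg_before_le)
  then show "finite {y. queried qs x y}" "card {y. queried qs x y} \<le> deg qs x"
    using card_queried_early_le[of qs x "deg qs x"] by auto
qed

lemma sum_deg_le: "finite V \<Longrightarrow> (\<Sum>x\<in>V. deg qs x) \<le> 2 * length qs"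
proof (induction qs rule: rev_induct)
  case Nil
  then show ?case by simp
next
  case (snoc e qs)
  have "(\<Sum>x\<in>V. deg [e] x) \<le> (\<Sum>x\<in>V. (if fst e = x then 1 else 0) + (if snd e = x then 1 else 0))"
    by (intro sum_mono) auto
  also have "\<dots> \<le> 2"
    using snoc.prems by (simp add: sum.distrib sum.delta')
  finally show ?case
    using snoc by (simp add: sum.distrib del: deg_simps(3))
qed

text \<open>Markov's inequality for the degree sum; the factor 2 stands for the two endpoints of a
  query.\<close>

lemma card_high_deg_le:
  assumes "finite V"
  shows "card {x \<in> V. deg qs x > T} * Suc T \<le> 2 * length qs"
proof -
  have "card {x \<in> V. deg qs x > T} * Suc T = (\<Sum>x\<in>{x \<in> V. deg qs x > T}. Suc T)"
    by simp
  also have "\<dots> \<le> (\<Sum>x\<in>{x \<in> V. deg qs x > T}. deg qs x)"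
    by (intro sum_mono) auto
  also have "\<dots> \<le> 2 * length qs"
    using assms by (intro sum_deg_le) auto
  finally show ?thesis .
qed

section \<open>The adversary's distances\<close>

text \<open>A pair with one point in \<open>S\<close> ignores the degree of the other point, and a
  pair inside \<open>S\<close> ignores both. Hence a low point of \<open>S\<close> is at distance 3
  even from high points.\<close>

definition answer :: "nat set \<Rightarrow> nat \<Rightarrow> (nat \<times> nat) list \<Rightarrow> nat \<Rightarrow> nat \<Rightarrow> real" where
  "answer S T qs x y =
     (if x = y then 0
      else if x \<in> S \<and> y \<in> S then 3
      else if x \<in> S then (if deg qs x > T then 4 else 3)
      else if y \<in> S then (if deg qs y > T then 4 else 3)
      else if deg qs x > T \<or> deg qs y > T then 4 else 2)"

text \<open>
  Freezing each pair at the state just before its first query makes the same function serve both as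
  the answer to a new or repeated query and as a metric consistent with all answers given so far.
\<close>

definition adv :: "nat set \<Rightarrow> nat \<Rightarrow> (nat \<times> nat) list \<Rightarrow> nat \<Rightarrow> nat \<Rightarrow> real" where
  "adv S T qs x y = answer S T (before qs x y) x y"

lemma adv_self [simp]: "adv S T qs x x = 0"
  by (simp add: adv_def answer_def)

lemma adv_commute: "adv S T qs x y = adv S T qs y x"
  unfolding adv_def before_commute[of qs x y] by (simp add: answer_def)

lemma adv_bounds: "x \<noteq> y \<Longrightarrow> 2 \<le> adv S T qs x y \<and> adv S T qs x y \<le> 4"
  by (simp add: adv_def answer_def)

lemma adv_append: "queried qs x y \<Longrightarrow> adv S T (qs @ rs) x y = adv S T qs x y"
  by (simp add: adv_def before_append)

lemma adv_snoc: "adv S T (qs @ [(x, y)]) x y = adv S T qs x y"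
  by (simp add: adv_def before_snoc)

text \<open>Distinct points have distances between 2 and 4, and 4 = 2 + 2.\<close>

lemma Metric_space_adv: "Metric_space M (adv S T qs)"
proof
  fix x y z
  show "0 \<le> adv S T qs x y"
    using adv_bounds[of x y S T qs] by (cases "x = y") auto
  show "adv S T qs x y = adv S T qs y x"
    by (rule adv_commute)
  show "adv S T qs x y = 0 \<longleftrightarrow> x = y"
    using adv_bounds[of x y S T qs] by (cases "x = y") auto
  show "adv S T qs x z \<le> adv S T qs x y + adv S T qs y z"
    using adv_bounds[of x y S T qs] adv_bounds[of y z S T qs] adv_bounds[of x z S T qs]
    by (cases "x = y"; cases "y = z"; cases "x = z") auto
qed

section \<open>Planting a median\<close>

definition near :: "nat set \<Rightarrow> nat \<Rightarrow> (nat \<times> nat) list \<Rightarrow> nat \<Rightarrow> nat \<Rightarrow> bool" where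
  "near S T qs z y \<longleftrightarrow> y \<notin> S \<and> deg qs y \<le> T \<and> \<not> queried qs z y"

definition planted :: "nat set \<Rightarrow> nat \<Rightarrow> (nat \<times> nat) list \<Rightarrow> nat \<Rightarrow> nat \<Rightarrow> nat \<Rightarrow> real" where
  "planted S T qs z x y =
     (if x = z \<and> near S T qs z y \<or> y = z \<and> near S T qs z x then 1 else adv S T qs x y)"

lemma planted_queried:
  "queried qs x y \<Longrightarrow> planted S T qs z x y = adv S T qs x y"
  by (auto simp: planted_def near_def queried_def)

lemma planted_eq_adv:
  "x \<noteq> z \<Longrightarrow> y \<noteq> z \<Longrightarrow> planted S T qs z x y = adv S T qs x y"
  by (simp add: planted_def)

lemma planted_commute: "planted S T qs z x y = planted S T qs z y x"
  using adv_commute[of S T qs x y] by (auto simp: planted_def)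

text \<open>Degrees only grow along the list, so \<open>z\<close>, low at the end, was low whenever
  one of its distances was frozen.\<close>

lemma planted_center:
  assumes "z \<in> S" "deg qs z \<le> T" "y \<noteq> z"
  shows "planted S T qs z z y = (if near S T qs z y then 1 else 3)"
  using assms deg_before_le[of qs z y z]
  by (auto simp: planted_def adv_def answer_def near_def)

text \<open>Points low at the end were low at every earlier time.\<close>

lemma adv_near:
  assumes "near S T qs z x" "near S T qs z y" "x \<noteq> y"
  shows "adv S T qs x y = 2"
  using assms deg_before_le[of qs x y x] deg_before_le[of qs x y y]
  by (auto simp: adv_def answer_def near_def)

lemma Metric_space_planted:
  assumes z: "z \<in> S" "deg qs z \<le> T"
  shows "Metric_space M (planted S T qs z)"
proof
  let ?d = "planted S T qs z"
  note c = planted_center[OF z]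
  have self: "?d x x = 0" for x
    using z by (auto simp: planted_def near_def)
  have pos: "?d x y > 0" if "x \<noteq> y" for x y
    using that adv_bounds[OF that, of S T qs] by (auto simp: planted_def)
  fix x y w
  show "0 \<le> ?d x y"
    using self pos[of x y] by (cases "x = y") auto
  show "?d x y = ?d y x"
    by (rule planted_commute)
  show "?d x y = 0 \<longleftrightarrow> x = y"
    using self pos[of x y] by (cases "x = y") auto
  \<comment> \<open>Distances from \<open>z\<close> are 1 or 3. The first inequality holds since
    they differ by at most 2; in the second, the sum is at least 4 unless both points are near, when
    \<open>adv_near\<close> applies.\<close>
  have off: "?d z u \<le> ?d z v + adv S T qs u v \<and> adv S T qs u v \<le> ?d z u + ?d z v"
    if "u \<noteq> v" "u \<noteq> z" "v \<noteq> z" for u v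
    using adv_bounds[OF that(1), of S T qs] adv_near[OF _ _ that(1), of S T qs z] that
    by (simp add: c)
  show "?d x w \<le> ?d x y + ?d y w"
  proof (cases "x = y \<or> y = w \<or> x = w")
    case True
    then show ?thesis
      using self pos[of x y] pos[of y w] planted_commute[of S T qs z] by (cases "x = y") auto
  next
    case False
    consider "x = z" | "y = z" | "w = z" | "x \<noteq> z" "y \<noteq> z" "w \<noteq> z" by blast
    then show ?thesis
    proof cases
      case 1
      then show ?thesis
        using False off[of w y] by (simp add: planted_eq_adv adv_commute[of S T qs y w])
    next
      case 2
      then show ?thesis
        using False off[of x w]
        by (simp add: planted_eq_adv planted_commute[of S T qs z x z])
    next
      case 3
      then show ?thesis
        using False off[of x y]
        by (simp add: planted_eq_adv planted_commute[of S T qs z _ z])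
    next
      case 4
      then show ?thesis
        using False adv_bounds[of x w S T qs] adv_bounds[of x y S T qs] adv_bounds[of y w S T qs]
        by (simp add: planted_eq_adv)
    qed
  qed
qed

section \<open>Total distances from the planted point and from a high point\<close>

text \<open>Points outside \<open>S\<close> that are neither high nor queried with \<open>z\<close>
  contribute 1, all others at most 1 + 2. At most \<open>T\<close> points were queried with
  \<open>z\<close>, because \<open>z\<close> is low.\<close>

lemma total_dist_center_le:
  assumes z: "z \<in> S" "deg qs z \<le> T" and "finite S"
  shows "total_dist n (planted S T qs z) z
    \<le> n + 2 * (card S + card {x \<in> {1..n}. deg qs x > T} + T)"
proof -
  let ?d = "planted S T qs z"
  let ?H = "{x \<in> {1..n}. deg qs x > T}" and ?Q = "{y. queried qs z y}"
  let ?B = "S \<union> ?H \<union> ?Q"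
  have fin: "finite ?B"
    using assms card_queried_le by auto
  have "card ?B \<le> card S + card ?H + card ?Q"
    by (meson card_Un_le add_le_mono le_refl le_trans)
  also have "card ?Q \<le> T"
    using card_queried_le(2)[of qs z] z by linarith
  finally have B: "card ?B \<le> card S + card ?H + T" by simp
  have "total_dist n ?d z \<le> (\<Sum>y\<in>{1..n}. 1 + 2 * (if y \<in> ?B then 1 else 0))"
    unfolding total_dist_def
  proof (rule sum_mono)
    fix y assume y: "y \<in> {1..n}"
    show "?d z y \<le> 1 + 2 * (if y \<in> ?B then 1 else 0)"
    proof (cases "y = z")
      case True
      then show ?thesis using z by (simp add: planted_def near_def)
    next
      case False
      with y show ?thesis by (auto simp: planted_center[OF z] near_def)
    qed
  qed
  also have "\<dots> = n + 2 * card ({1..n} \<inter> ?B)"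
    by (simp add: sum.distrib sum_distrib_left[symmetric] sum.If_cases del: Un_iff)
  also have "\<dots> \<le> n + 2 * card ?B"
    using card_mono[OF fin, of "{1..n} \<inter> ?B"] by simp
  also have "\<dots> \<le> n + 2 * (card S + card ?H + T)"
    using B by simp
  finally show ?thesis by simp
qed

text \<open>The exceptions are \<open>p\<close>, the points of \<open>S\<close> and at most
  \<open>T + 1\<close> partners queried while \<open>p\<close> was low. Every other point is at
  distance 4, either frozen when \<open>p\<close> was high or unqueried and judged by the final
  degree.\<close>

lemma total_dist_high_ge:
  assumes p: "deg qs p > T" "p \<noteq> z" and z: "z \<in> S" "deg qs z \<le> T" and "finite S"
  shows "total_dist n (planted S T qs z) p \<ge> 4 * (real n - (card S + T + 2))"
proof -
  let ?d = "planted S T qs z"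
  let ?E = "{y. queried qs p y \<and> deg (before qs p y) p \<le> T}"
  let ?B = "insert p (S \<union> ?E)"
  have E: "finite ?E" "card ?E \<le> Suc T"
    using card_queried_early_le[of qs p T] by auto
  have "card ?B \<le> Suc (card (S \<union> ?E))"
    using E(1) \<open>finite S\<close> by (simp add: card_insert_if)
  also have "\<dots> \<le> Suc (card S + card ?E)"
    using card_Un_le[of S ?E] by simp
  finally have B: "card ?B \<le> card S + T + 2"
    using E(2) by simp
  have "n - card ?B \<le> card ({1..n} - ?B)"
    using diff_card_le_card_Diff[of ?B "{1..n}"] E(1) \<open>finite S\<close> by simp
  then have "real n - card ?B \<le> card ({1..n} - ?B)"
    by linarith
  then have "4 * (real n - (card S + T + 2)) \<le> (\<Sum>y\<in>{1..n} - ?B. 4)"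
    using B by simp
  also have "\<dots> \<le> (\<Sum>y\<in>{1..n} - ?B. ?d p y)"
  proof (rule sum_mono)
    fix y assume y: "y \<in> {1..n} - ?B"
    then have "deg (before qs p y) p > T"
      using p before_unqueried[of qs p y] by (cases "queried qs p y") auto
    then have "adv S T qs p y = 4"
      using y by (auto simp: adv_def answer_def)
    moreover have "y \<noteq> z" using y z by auto
    ultimately show "4 \<le> ?d p y"
      using p by (simp add: planted_eq_adv)
  qed
  also have "\<dots> \<le> total_dist n ?d p"
    unfolding total_dist_def
    using Metric_space.nonneg[OF Metric_space_planted[OF z, of UNIV]]
    by (intro sum_mono2) auto
  finally show ?thesis .
qed

section \<open>Running the algorithm against the adversary\<close>

text \<open>Only queries are stored. Recomputing the answers from the longer list is sound for
  \<open>adv\<close>, whose values on queried pairs are frozen.\<close>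

inductive transcript ::
  "algorithm \<Rightarrow> nat \<Rightarrow> ((nat \<times> nat) list \<Rightarrow> nat \<Rightarrow> nat \<Rightarrow> real) \<Rightarrow> (nat \<times> nat) list \<Rightarrow> bool"
  for A :: algorithm and n :: nat and D
where
  start: "transcript A n D []"
| step: "transcript A n D qs \<Longrightarrow> A n (map (case_prod (D qs)) qs) = Query x y \<Longrightarrow>
    transcript A n D (qs @ [(x, y)])"

text \<open>An input that agrees with the adversary on the queried pairs cannot be told apart from
  it. This serves both for \<open>adv\<close> itself and for the planted metric.\<close>

lemma runs_transcript:
  assumes "transcript A n (adv S T) qs"
    and "\<And>x y. (x, y) \<in> set qs \<Longrightarrow> d x y = adv S T qs x y"
    and "runs A n d [] k p"
  shows "\<exists>k'. k = length qs + k' \<and> runs A n d (map (case_prod (adv S T qs)) qs) k' p"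
  using assms
proof (induction rule: transcript.induct)
  case start
  then show ?case by simp
next
  case (step qs x y)
  let ?a = "adv S T"
  have old: "?a (qs @ [(x, y)]) u v = ?a qs u v" if "(u, v) \<in> set qs" for u v
    using that by (intro adv_append) (auto simp: queried_def)
  have "d u v = ?a qs u v" if "(u, v) \<in> set qs" for u v
    using step.prems(1)[of u v] old[OF that] that by simp
  then obtain k' where k': "k = length qs + k'" "runs A n d (map (case_prod (?a qs)) qs) k' p"
    using step.IH step.prems by blast
  have dxy: "d x y = ?a qs x y"
    using step.prems(1)[of x y] by (simp add: adv_snoc)
  have "map (case_prod (?a (qs @ [(x, y)]))) (qs @ [(x, y)]) = map (case_prod (?a qs)) qs @ [d x y]"
    using old dxy by (auto simp: adv_snoc intro!: map_cong)
  moreover from k'(2) obtain k'' where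
    "k' = Suc k''" "runs A n d (map (case_prod (?a qs)) qs @ [d x y]) k'' p"
    by cases (use step.hyps(2) in auto)
  ultimately show ?case using k'(1)
    by (simp del: map_append)
qed

text \<open>Each \<open>adv S T qs\<close> is a legal input, so no transcript is longer than
  \<open>q n\<close>; after a longest one the algorithm can only output.\<close>

lemma transcript_terminates:
  assumes "query_complexity_le A q" "n \<ge> 1"
  obtains qs p where "transcript A n (adv S T) qs"
    "A n (map (case_prod (adv S T qs)) qs) = Output p" "length qs \<le> q n"
proof -
  let ?a = "adv S T"
  have run: "length qs \<le> q n \<and>
      (\<exists>k p. runs A n (?a qs) (map (case_prod (?a qs)) qs) k p)"
    if "transcript A n ?a qs" for qs
  proof -
    obtain k p where "runs A n (?a qs) [] k p" "k \<le> q n"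
      using assms Metric_space_adv unfolding query_complexity_le_def by blast
    with runs_transcript[OF that, of "?a qs"] show ?thesis
      by (metis add_leD1)
  qed
  define l where "l = (GREATEST l. \<exists>qs. transcript A n ?a qs \<and> length qs = l)"
  have "\<exists>l qs. transcript A n ?a qs \<and> length qs = l"
    using transcript.start by blast
  moreover have bdd: "\<exists>qs. transcript A n ?a qs \<and> length qs = l \<Longrightarrow> l \<le> q n" for l
    using run by blast
  ultimately obtain qs where qs: "transcript A n ?a qs" "length qs = l"
    using GreatestI_ex_nat[of "\<lambda>l. \<exists>qs. transcript A n ?a qs \<and> length qs = l" "q n"]
    unfolding l_def by blast
  have "length rs \<le> l" if "transcript A n ?a rs" for rs
    unfolding l_def using that bdd
    by (intro Greatest_le_nat[where b = "q n"]) blast+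
  then have no_query: "A n (map (case_prod (?a qs)) qs) \<noteq> Query x y" for x y
    using transcript.step[OF qs(1), of x y] qs(2) by fastforce
  from run[OF qs(1)] obtain p where "A n (map (case_prod (?a qs)) qs) = Output p"
    by (metis action.exhaust no_query)
  then show ?thesis
    using that qs(1) run[OF qs(1)] by blast
qed

text \<open>
  Appending \<open>m + 1\<close> dummy queries \<open>(p, p)\<close> turns the output \<open>p\<close> into a point of high degree without
  touching any answer given.
\<close>

lemma approximation_forces_queries:
  assumes q: "query_complexity_le A q" and A: "approximates_median A \<alpha>"
    and n: "n \<ge> 1" and m: "m \<le> n"
    and few: "2 * (q n + Suc m) < m * Suc m"
    and \<alpha>: "\<alpha> \<le> \<beta>" "\<beta> \<ge> 0"
  shows "4 * (real n - (2 * real m + 2)) \<le> \<beta> * (real n + 6 * real m)"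
proof -
  let ?S = "{1..m}"
  obtain qs p where qs: "transcript A n (adv ?S m) qs"
    "A n (map (case_prod (adv ?S m qs)) qs) = Output p" "length qs \<le> q n"
    using transcript_terminates[OF q n] by blast
  define rs where "rs = qs @ replicate (Suc m) (p, p)"
  let ?H = "{x \<in> {1..n}. deg rs x > m}"
  have p: "deg rs p > m"
    by (simp add: rs_def deg_replicate_self del: replicate.simps)
  have "card ?H * Suc m \<le> 2 * length rs"
    by (rule card_high_deg_le) simp
  also have "\<dots> < m * Suc m"
    using few qs(3) by (simp add: rs_def)
  finally have H: "card ?H < m"
    using mult_less_cancel2 by blast
  have "\<not> ?S \<subseteq> ?H"
    using card_mono[of ?H ?S] H by auto
  then obtain z where z: "z \<in> ?S" "deg rs z \<le> m"
    using m by force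
  let ?d = "planted ?S m rs z"
  have metric: "Metric_space {1..n} ?d"
    by (rule Metric_space_planted[OF z])
  have agree: "?d x y = adv ?S m qs x y" if "(x, y) \<in> set qs" for x y
    using that planted_queried[of rs x y] adv_append[of qs x y]
    by (auto simp: queried_def rs_def)
  obtain k p' where run: "runs A n ?d [] k p'"
    and le: "total_dist n ?d p' \<le> \<alpha> * (MIN x'\<in>{1..n}. total_dist n ?d x')"
    using A n metric unfolding approximates_median_def by blast
  from runs_transcript[OF qs(1) agree run] obtain k'
    where "runs A n ?d (map (case_prod (adv ?S m qs)) qs) k' p'" by blast
  then have "p' = p"
    by cases (use qs(2) in auto)
  have nonneg: "0 \<le> total_dist n ?d x" for x
    unfolding total_dist_def by (intro sum_nonneg Metric_space.nonneg[OF metric])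
  have min: "0 \<le> (MIN x'\<in>{1..n}. total_dist n ?d x')"
    "(MIN x'\<in>{1..n}. total_dist n ?d x') \<le> total_dist n ?d z"
    using n z m nonneg by auto
  \<comment> \<open>Here \<open>card ?S\<close> and the threshold are both \<open>m\<close>, and
    \<open>p\<close> differs from \<open>z\<close> because only \<open>p\<close> is high.\<close>
  have "4 * (real n - (2 * real m + 2)) \<le> total_dist n ?d p"
    using total_dist_high_ge[OF p _ z, of n] p z by fastforce
  also have "\<dots> \<le> \<beta> * (MIN x'\<in>{1..n}. total_dist n ?d x')"
    using le \<open>p' = p\<close> mult_right_mono[OF \<alpha>(1) min(1)] by simp
  also have "\<dots> \<le> \<beta> * total_dist n ?d z"
    using min(2) \<alpha>(2) by (rule mult_left_mono)
  \<comment> \<open>The set \<open>?S\<close>, the high points and the threshold contribute at most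
    \<open>m\<close> each, every unit costing 2.\<close>
  also have "\<dots> \<le> \<beta> * (real n + 6 * real m)"
    using total_dist_center_le[OF z, of n] H \<alpha>(2) by (intro mult_left_mono) auto
  finally show ?thesis .
qed

section \<open>Asymptotic choice of parameters\<close>

theorem theorem2:
  fixes \<epsilon> :: real
  assumes "\<epsilon> > 0"
  shows "\<not> (\<exists>(A :: algorithm) (q :: nat \<Rightarrow> nat).
           (\<lambda>n. real (q n)) \<in> o(\<lambda>n. real n ^ 2) \<and>
           query_complexity_le A q \<and>
           approximates_median A (4 - \<epsilon>))"
proof
  assume "\<exists>(A :: algorithm) (q :: nat \<Rightarrow> nat).
           (\<lambda>n. real (q n)) \<in> o(\<lambda>n. real n ^ 2) \<and>
           query_complexity_le A q \<and>
           approximates_median A (4 - \<epsilon>)"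
  then obtain A q where o: "(\<lambda>n. real (q n)) \<in> o(\<lambda>n. real n ^ 2)"
    and q: "query_complexity_le A q" and A: "approximates_median A (4 - \<epsilon>)" by blast
  \<comment> \<open>Capping at 1 keeps the factor \<open>4 - e\<close> nonnegative even when
    \<epsilon> exceeds 4.\<close>
  define e where "e = min \<epsilon> 1"
  \<comment> \<open>With this choice the error \<open>32 * real m\<close> is at most half of
    \<open>e * n\<close>.\<close>
  define \<delta> where "\<delta> = e / 64"
  have e: "0 < e" "e \<le> 1" "e \<le> \<epsilon>" and \<delta>: "0 < \<delta>" "\<delta> \<le> 1"
    using assms by (auto simp: e_def \<delta>_def)
  \<comment> \<open>The quarter makes twice the query count at most about half of
    \<open>m * Suc m\<close>, leaving room for the dummy queries.\<close>
  have "\<forall>\<^sub>F n in sequentially. real (q n) \<le> \<delta>\<^sup>2 / 4 * real n ^ 2"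
    using landau_o.smallD[OF o, of "\<delta>\<^sup>2 / 4"] \<delta>(1) by simp
  moreover have "\<forall>\<^sub>F n in sequentially. real n \<ge> max (10 / \<delta>) 1"
    using eventually_ge_at_top[of "nat \<lceil>max (10 / \<delta>) 1\<rceil>"]
    by eventually_elim linarith
  ultimately obtain n where n: "real (q n) \<le> \<delta>\<^sup>2 / 4 * real n ^ 2" "real n \<ge> max (10 / \<delta>) 1"
    using eventually_happens'[OF sequentially_bot eventually_conj] by blast
  define m where "m = nat \<lfloor>\<delta> * n\<rfloor>"
  have large: "10 \<le> \<delta> * n"
    using n(2) \<delta>(1) by (simp add: field_simps)
  have m: "real m \<le> \<delta> * n" "\<delta> * n < real m + 1"
    using \<delta> by (auto simp: m_def)
  have "real m \<le> n"
    using m(1) \<delta> mult_right_mono[of \<delta> 1 "real n"] by simp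
  have "real (q n) \<le> (\<delta> * n) * (\<delta> * n) / 4"
    using n(1) by (simp add: power2_eq_square algebra_simps)
  also have "\<dots> \<le> (real m + 1) * (real m + 1) / 4"
    using m(2) large by (intro divide_right_mono mult_mono) auto
  finally have "2 * (real (q n) + (real m + 1)) \<le> ((real m + 1) / 2 + 2) * (real m + 1)"
    by (simp add: algebra_simps)
  also have "\<dots> < real m * (real m + 1)"
  proof (rule mult_strict_right_mono)
    have "9 < real m"
      using m(2) large by simp
    then show "(real m + 1) / 2 + 2 < real m"
      by (simp add: field_simps)
  qed simp
  finally have "real (2 * (q n + Suc m)) < real (m * Suc m)"
    by (simp add: algebra_simps)
  then have "2 * (q n + Suc m) < m * Suc m"
    by linarith
  from approximation_forces_queries[OF q A _ _ this, of "4 - e"] n(2) \<open>real m \<le> n\<close> e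
  have "4 * (real n - (2 * real m + 2)) \<le> (4 - e) * (real n + 6 * real m)"
    by simp
  then have "e * n \<le> 32 * real m + 8 - 6 * (e * real m)"
    by (simp add: algebra_simps)
  also have "\<dots> \<le> 32 * (\<delta> * n) + 8"
  proof -
    have "0 \<le> e * real m" "32 * real m \<le> 32 * (\<delta> * n)"
      using m(1) e(1) by simp_all
    then show ?thesis by simp
  qed
  finally have "32 * (\<delta> * n) \<le> 8"
    by (simp add: \<delta>_def)
  with large show False by simp
qed

end
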